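(* Let $m^\star$ be a monotone non-increasing probability density on $[0,\infty)$ with uniform-mixture representation $m^\star(x)=\int_0^\infty\mathsf{Unif}(x\mid 0,u)\,P^\star(du)$ and distribution function $M^\star$. Fix $0<\ell<L<\infty$ and define $$m^\dagger(x)=\frac{P^\star([0,\ell])}{M^\star(L)}\,\mathsf{Unif}(x\mid 0,\ell)+\frac{1}{M^\star(L)}\int_{(\ell,L)}\mathsf{Unif}(x\mid 0,u)\,P^\star(du)+\frac{L\,m^\star(L)}{M^\star(L)}\,\mathsf{Unif}(x\mid 0,L),\quad x\ge0.$$ Then $$\int_0^\infty|m^\dagger(x)-m^\star(x)|\,dx\le 2\bigl\{1-M^\star(L)+M^\star(L)^{-1}P^\star([0,\ell])\bigr\}.$$
   Context: $\mathsf{Unif}(x\mid 0,u)=u^{-1}1_{[0,u]}(x)$ for $u>0$ is the uniform kernel density. Every monotone non-increasing density $m^\star$ on $[0,\infty)$ can be written as $m^\star(x)=\int_0^\infty\mathsf{Unif}(x\mid0,u)\,P^\star(du)$ for a probability measure $P^\star$ on $[0,\infty)$ with $P^\star(\{0\})=0$; this formula fixes the version of $m^\star$ used, in particular $m^\star(L)=\int_{[L,\infty)}u^{-1}\,P^\star(du)$. The density $m^\dagger$ is the best approximation, in Kullback--Leibler divergence, of $m^\star$ restricted and renormalized to $[0,L]$ by uniform mixtures $\int\mathsf{Unif}(x\mid0,u)\,P(du)$ with $P$ a probability measure on $[\ell,L]$. *)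

theory Defs
  imports "HOL-Probability.Probability"
begin

text \<open>The density at \<open>x\<close> of the uniform distribution on \<open>[0, u]\<close>, for \<open>u > 0\<close>.  The value
  at \<open>u = 0\<close> is \<open>0\<close>, which is irrelevant for mixing measures without an atom at \<open>0\<close>.\<close>

definition unif_density :: "real \<Rightarrow> real \<Rightarrow> real" where
  "unif_density u x = indicator {0..u} x / u"

text \<open>Densities on \<open>[0, \<infinity>)\<close> are extended by \<open>0\<close> to the real line.  They take values in
  \<^typ>\<open>ennreal\<close> because a non-increasing density may be infinite at \<open>0\<close> (and only there).\<close>

definition nonincreasing_density :: "(real \<Rightarrow> ennreal) \<Rightarrow> bool" where
  "nonincreasing_density m \<longleftrightarrow>
     m \<in> borel_measurable borel \<and> (\<forall>x<0. m x = 0) \<and> antimono_on {0..} m \<and>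
     (\<integral>\<^sup>+x. m x \<partial>lborel) = 1"

definition mixing_measure :: "real measure \<Rightarrow> bool" where
  "mixing_measure P \<longleftrightarrow>
     prob_space P \<and> sets P = sets borel \<and> measure P {..<0} = 0 \<and> measure P {0} = 0"

definition unif_mixture :: "real measure \<Rightarrow> real \<Rightarrow> ennreal" where
  "unif_mixture P x = (\<integral>\<^sup>+u. ennreal (unif_density u x) \<partial>P)"

definition distr_fun :: "(real \<Rightarrow> ennreal) \<Rightarrow> real \<Rightarrow> real" where
  "distr_fun m = cdf (density lborel m)"

text \<open>The conversion of \<open>m L\<close> to a real number loses nothing: \<open>m L\<close> is finite for \<open>L > 0\<close>.\<close>

definition m_dagger ::
    "real measure \<Rightarrow> (real \<Rightarrow> ennreal) \<Rightarrow> real \<Rightarrow> real \<Rightarrow> real \<Rightarrow> real" where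
  "m_dagger P m l L x =
     measure P {0..l} / distr_fun m L * unif_density l x
     + 1 / distr_fun m L * (LINT u:{l<..<L}|P. unif_density u x)
     + L * enn2real (m L) / distr_fun m L * unif_density L x"

text \<open>The \<open>L\<^sup>1\<close> distance on \<open>[0, \<infinity>)\<close> as an extended nonnegative integral, so that an upper bound
  also asserts integrability.  The difference is formed in the extended reals, where it makes
  sense even if \<open>m 0 = \<infinity>\<close>.\<close>

definition l1_dist :: "(real \<Rightarrow> real) \<Rightarrow> (real \<Rightarrow> ennreal) \<Rightarrow> ennreal" where
  "l1_dist f m = (\<integral>\<^sup>+x\<in>{0..}. e2ennreal \<bar>ereal (f x) - enn2ereal (m x)\<bar> \<partial>lborel)"

end

theory Submission
  imports Defs
begin

text \<open>On \<open>[0, L]\<close> split \<open>m = A + B + C\<close> according to whether the mixing variable lies in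
  \<open>(0, l]\<close>, \<open>(l, L)\<close> or \<open>[L, \<infinity>)\<close>; there \<open>C\<close> is the constant \<open>m L\<close>.  With \<open>M\<close> the mass of
  \<open>[0, L]\<close> and \<open>p\<close> the mixing mass of \<open>[0, l]\<close>, the approximation is \<open>(p unif_l + B + C) / M\<close>,
  so the error is at most \<open>p unif_l / M + A + (1 / M - 1) (B + C)\<close> on \<open>[0, L]\<close> and equals \<open>m\<close>
  beyond \<open>L\<close>.  By Tonelli, \<open>A\<close> has integral \<open>a \<le> p\<close>, and \<open>B + C\<close> has integral \<open>M - a\<close>.\<close>

lemma unif_density_nonneg: "0 \<le> unif_density u x"
  by (auto simp: unif_density_def indicator_def)

lemma unif_density_le: "0 < b \<Longrightarrow> b \<le> u \<Longrightarrow> unif_density u x \<le> 1 / b"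
  by (auto simp: unif_density_def indicator_def frac_le)

lemma unif_density_le_inverse: "0 < x \<Longrightarrow> unif_density u x \<le> 1 / x"
  by (auto simp: unif_density_def indicator_def frac_le)

text \<open>The support \<open>{0..u}\<close> moves with \<open>u\<close>, so the kernel is
  rewritten as a conditional on two comparisons. This gives joint measurability in parameter and
  point, as Tonelli requires.\<close>

lemma borel_measurable_unif_density [measurable (raw)]:
  assumes [measurable]: "f \<in> borel_measurable N" "g \<in> borel_measurable N"
  shows "(\<lambda>w. unif_density (f w) (g w)) \<in> borel_measurable N"
proof -
  have "(\<lambda>w. unif_density (f w) (g w)) = (\<lambda>w. if 0 \<le> g w \<and> g w \<le> f w then 1 / f w else 0)"
    by (auto simp: unif_density_def fun_eq_iff)
  also have "\<dots> \<in> borel_measurable N"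
    by measurable
  finally show ?thesis .
qed

text \<open>For \<open>u < 0\<close> the support is empty, and at \<open>u = 0\<close> the quotient
  is \<open>0\<close> since division by zero yields \<open>0\<close>; so only \<open>u > 0\<close>
  carries mass.\<close>

lemma nn_integral_unif_density:
  "(\<integral>\<^sup>+x. ennreal (unif_density u x) \<partial>lborel) = indicator {0<..} u"
proof (cases "0 < u")
  case True
  have "(\<integral>\<^sup>+x. ennreal (unif_density u x) \<partial>lborel)
      = (\<integral>\<^sup>+x. ennreal (1 / u) * indicator {0..u} x \<partial>lborel)"
    by (intro nn_integral_cong) (auto simp: unif_density_def indicator_def)
  also have "\<dots> = ennreal (1 / u) * ennreal u"
    using True by (simp add: nn_integral_cmult_indicator)
  also have "\<dots> = 1"
    using True by (simp flip: ennreal_mult')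
  finally show ?thesis
    using True by simp
next
  case False
  then have "unif_density u x = 0" for x
    by (auto simp: unif_density_def indicator_def)
  with False show ?thesis
    by simp
qed

text \<open>If \<open>u \<ge> L\<close>, both \<open>x\<close> and \<open>L\<close> lie in
  \<open>[0, u]\<close>, so the kernel has the same value \<open>1 / u\<close> at both; if
  \<open>u < L\<close>, it vanishes at \<open>L\<close>. Hence the last summand is exactly the part
  with \<open>u \<ge> L\<close>, free of \<open>x\<close>.\<close>

lemma unif_density_split:
  assumes "0 < l" "l < L" "0 \<le> x" "x \<le> L"
  shows "ennreal (unif_density u x) =
    ennreal (unif_density u x) * indicator {..l} u
    + ennreal (unif_density u x) * indicator {l<..<L} u + ennreal (unif_density u L)"
  using assms by (auto simp: unif_density_def indicator_def)

context
  fixes P :: "real measure"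
  assumes prob: "prob_space P" and sets_P [measurable_cong]: "sets P = sets borel"
begin

interpretation prob_space P by (rule prob)

lemma unif_mixture_split:
  assumes "0 < l" "l < L" "0 \<le> x" "x \<le> L"
  shows "unif_mixture P x =
    (\<integral>\<^sup>+u\<in>{..l}. ennreal (unif_density u x) \<partial>P)
    + (\<integral>\<^sup>+u\<in>{l<..<L}. ennreal (unif_density u x) \<partial>P) + unif_mixture P L"
  unfolding unif_mixture_def
  by (subst unif_density_split[OF assms]) (simp add: nn_integral_add)

text \<open>Averaging the pointwise bound over a probability measure keeps it. This makes the
  mixture finite away from \<open>0\<close>.\<close>

lemma unif_mixture_le:
  assumes "0 < x"
  shows "unif_mixture P x \<le> ennreal (1 / x)"
proof -
  have "unif_mixture P x \<le> (\<integral>\<^sup>+u. ennreal (1 / x) \<partial>P)"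
    unfolding unif_mixture_def
    by (intro nn_integral_mono ennreal_leI unif_density_le_inverse assms)
  then show ?thesis
    by (simp add: emeasure_space_1)
qed

text \<open>The kernel is bounded by \<open>1 / l\<close> for \<open>u > l\<close>, hence
  integrable. This links the Bochner integral in \<open>m_dagger\<close> with the nonnegative
  integral in the mixture.\<close>

lemma nn_integral_unif_density_middle:
  assumes "0 < l"
  shows "(\<integral>\<^sup>+u\<in>{l<..<L}. ennreal (unif_density u x) \<partial>P)
    = ennreal (LINT u:{l<..<L}|P. unif_density u x)"
proof -
  have "integrable P (\<lambda>u. indicator {l<..<L} u *\<^sub>R unif_density u x)"
    using assms unif_density_le[of l _ x]
    by (intro integrable_const_bound[where B = "1 / l"])
       (auto simp: indicator_def unif_density_nonneg)
  then have "(\<integral>\<^sup>+u. ennreal (indicator {l<..<L} u *\<^sub>R unif_density u x) \<partial>P)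
      = ennreal (LINT u:{l<..<L}|P. unif_density u x)"
    unfolding set_lebesgue_integral_def
    by (intro nn_integral_eq_integral) (auto simp: unif_density_nonneg)
  moreover have "(\<integral>\<^sup>+u\<in>{l<..<L}. ennreal (unif_density u x) \<partial>P)
      = (\<integral>\<^sup>+u. ennreal (indicator {l<..<L} u *\<^sub>R unif_density u x) \<partial>P)"
    by (intro nn_integral_cong) (auto simp: indicator_def)
  ultimately show ?thesis
    by simp
qed

text \<open>After exchanging the integrals by Tonelli, each \<open>u\<close> in
  \<open>(0, l]\<close> contributes mass 1 and each \<open>u \<le> 0\<close> contributes
  nothing.\<close>

lemma nn_integral_unif_density_lower_le:
  "(\<integral>\<^sup>+x. (\<integral>\<^sup>+u\<in>{..l}. ennreal (unif_density u x) \<partial>P) \<partial>lborel) \<le> ennreal (measure P {0..l})"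
proof -
  interpret pair_sigma_finite P lborel ..
  have "(\<integral>\<^sup>+x. (\<integral>\<^sup>+u\<in>{..l}. ennreal (unif_density u x) \<partial>P) \<partial>lborel)
      = (\<integral>\<^sup>+u. (\<integral>\<^sup>+x. ennreal (unif_density u x) * indicator {..l} u \<partial>lborel) \<partial>P)"
    by (intro Fubini') measurable
  also have "\<dots> = (\<integral>\<^sup>+u. indicator {0<..} u * indicator {..l} u \<partial>P)"
    by (simp add: nn_integral_multc nn_integral_unif_density)
  also have "\<dots> \<le> (\<integral>\<^sup>+u. indicator {0..l} u \<partial>P)"
    by (intro nn_integral_mono) (auto simp: indicator_def)
  also have "\<dots> = ennreal (measure P {0..l})"
    by (simp add: sets_P emeasure_eq_measure)
  finally show ?thesis .
qed

end

lemma distr_fun_bounds: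
  assumes "nonincreasing_density m"
  shows "ennreal (distr_fun m L) = (\<integral>\<^sup>+x\<in>{0..L}. m x \<partial>lborel)"
    and "ennreal (1 - distr_fun m L) = (\<integral>\<^sup>+x\<in>{L<..}. m x \<partial>lborel)"
    and "0 \<le> distr_fun m L" and "distr_fun m L \<le> 1"
proof -
  have [measurable]: "m \<in> borel_measurable borel"
    and neg: "\<And>x. x < 0 \<Longrightarrow> m x = 0" and one: "(\<integral>\<^sup>+x. m x \<partial>lborel) = 1"
    using assms by (auto simp: nonincreasing_density_def)
  interpret D: prob_space "density lborel m"
    by rule (simp add: emeasure_density one)
  have "ennreal (distr_fun m L) = (\<integral>\<^sup>+x\<in>{..L}. m x \<partial>lborel)"
    by (simp add: distr_fun_def cdf_def emeasure_density flip: D.emeasure_eq_measure)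
  also have "\<dots> = (\<integral>\<^sup>+x\<in>{0..L}. m x \<partial>lborel)"
    by (intro nn_integral_cong) (auto simp: indicator_def neg not_le)
  finally show "ennreal (distr_fun m L) = (\<integral>\<^sup>+x\<in>{0..L}. m x \<partial>lborel)" .
  have "1 - distr_fun m L = measure (density lborel m) (space (density lborel m) - {..L})"
    by (subst D.prob_compl) (simp_all add: distr_fun_def cdf_def)
  also have "space (density lborel m) - {..L} = {L<..}"
    by auto
  finally show "ennreal (1 - distr_fun m L) = (\<integral>\<^sup>+x\<in>{L<..}. m x \<partial>lborel)"
    by (simp add: emeasure_density flip: D.emeasure_eq_measure)
  show "0 \<le> distr_fun m L" "distr_fun m L \<le> 1"
    by (simp_all add: distr_fun_def cdf_def)
qed

lemma e2ennreal_abs_diff_ennreal: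
  "0 \<le> b \<Longrightarrow> e2ennreal \<bar>ereal a - enn2ereal (ennreal b)\<bar> = ennreal \<bar>a - b\<bar>"
  by (simp add: enn2ereal_ennreal)

theorem proposition1:
  fixes m :: "real \<Rightarrow> ennreal" and P :: "real measure" and l L :: real
  assumes "nonincreasing_density m"
    and "mixing_measure P"
    and "\<And>x. 0 \<le> x \<Longrightarrow> m x = unif_mixture P x"
    and "0 < l" and "l < L"
  shows "l1_dist (m_dagger P m l L) m
           \<le> ennreal (2 * (1 - distr_fun m L + measure P {0..l} / distr_fun m L))"
proof -
  note mix = assms(3)
  have prob: "prob_space P" and sets_P [measurable_cong]: "sets P = sets borel"
    using assms(2) by (auto simp: mixing_measure_def)
  interpret prob_space P by (rule prob)
  have [measurable]: "m \<in> borel_measurable borel" and one: "(\<integral>\<^sup>+x. m x \<partial>lborel) = 1"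
    using assms(1) by (auto simp: nonincreasing_density_def)
  define M where "M = distr_fun m L"
  define p where "p = measure P {0..l}"
  define c where "c = enn2real (m L)"
  define A where "A x = (\<integral>\<^sup>+u\<in>{..l}. ennreal (unif_density u x) \<partial>P)" for x
  define b where "b x = (LINT u:{l<..<L}|P. unif_density u x)" for x
  note M = distr_fun_bounds[OF assms(1), of L, folded M_def]
  have p: "0 \<le> p"
    by (simp add: p_def)
  have finite: "m x < \<infinity>" if "0 < x" for x
    using le_less_trans[OF unif_mixture_le[OF prob sets_P that], of \<infinity>] mix[of x] that by simp
  have c: "m L = ennreal c" "0 \<le> c"
    using finite[of L] assms(4,5) by (simp_all add: c_def)
  have b_nonneg: "0 \<le> b x" for x
    unfolding b_def set_lebesgue_integral_def
    by (intro integral_nonneg_AE) (auto simp: unif_density_nonneg)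
  have A_meas [measurable]: "A \<in> borel_measurable borel"
    unfolding A_def by measurable
  have b_meas [measurable]: "b \<in> borel_measurable borel"
    unfolding b_def set_lebesgue_integral_def by measurable
  have m_split: "m x = A x + ennreal (b x + c)" if "0 \<le> x" "x \<le> L" for x
    using unif_mixture_split[OF prob sets_P assms(4,5) that] mix[of x] mix[of L] that
      nn_integral_unif_density_middle[OF prob sets_P assms(4), of x L] assms(4,5) c b_nonneg[of x]
    by (simp add: A_def b_def add.assoc)
  \<comment> \<open>No kernel with \<open>u \<le> l < L\<close> reaches beyond \<open>L\<close>, so
    \<open>A\<close> can be integrated over the whole line without a cutoff.\<close>
  have A_zero: "A x = 0" if "\<not> (0 \<le> x \<and> x \<le> L)" for x
  proof -
    have "ennreal (unif_density u x) * indicator {..l} u = 0" for u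
      using that assms(5) by (auto simp: unif_density_def indicator_def)
    then show ?thesis
      unfolding A_def by (simp only: nn_integral_const mult_zero_left)
  qed
  \<comment> \<open>On \<open>[0, L]\<close> the last kernel is \<open>1 / L\<close>, which cancels
    the factor \<open>L\<close> in \<open>m_dagger\<close> and leaves the constant
    \<open>c / M\<close>.\<close>
  have dag: "m_dagger P m l L x = p / M * unif_density l x + b x / M + c / M"
    if "0 \<le> x" "x \<le> L" for x
    using that assms(4,5)
    by (simp add: m_dagger_def M_def p_def b_def c_def unif_density_def)
  have dag_zero: "m_dagger P m l L x = 0" if "L < x" for x
  proof -
    have "indicator {l<..<L} u *\<^sub>R unif_density u x = 0" for u
      using that by (auto simp: unif_density_def indicator_def)
    then have "(LINT u:{l<..<L}|P. unif_density u x) = 0"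
      unfolding set_lebesgue_integral_def by (simp only: Bochner_Integration.integral_zero)
    then show ?thesis
      using that assms(5) by (simp add: m_dagger_def) (simp add: unif_density_def)
  qed
  have "l1_dist (m_dagger P m l L) m \<le> ennreal (2 * (1 - M + p / M))"
  proof (cases "M = 0")
    \<comment> \<open>Division by \<open>M = 0\<close> gives \<open>0\<close>, so the approximation
      vanishes and the distance is at most 1, while the claimed bound is 2.\<close>
    case True
    then have "m_dagger P m l L x = 0" for x
      by (simp add: m_dagger_def M_def)
    then have "l1_dist (m_dagger P m l L) m \<le> (\<integral>\<^sup>+x. m x \<partial>lborel)"
      unfolding l1_dist_def
      by (intro nn_integral_mono) (auto simp: indicator_def simp flip: zero_ereal_def)
    then show ?thesis
      using True one by (auto intro: order_trans)
  next
    case False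
    with M have M_pos: "0 < M" "M \<le> 1"
      by auto
    define a where "a = enn2real (\<integral>\<^sup>+x. A x \<partial>lborel)"
    have a_le': "(\<integral>\<^sup>+x. A x \<partial>lborel) \<le> ennreal p"
      unfolding A_def p_def by (rule nn_integral_unif_density_lower_le[OF prob sets_P])
    have a_eq: "(\<integral>\<^sup>+x. A x \<partial>lborel) = ennreal a"
      using le_less_trans[OF a_le', of \<infinity>] by (simp add: a_def)
    have a: "0 \<le> a" "a \<le> p"
      using a_le' p by (auto simp: a_eq a_def[symmetric]) (simp add: a_def)
    let ?Q = "\<integral>\<^sup>+x\<in>{0..L}. ennreal (b x + c) \<partial>lborel"
    have "ennreal M = (\<integral>\<^sup>+x. A x + ennreal (b x + c) * indicator {0..L} x \<partial>lborel)"
      unfolding M(1) by (intro nn_integral_cong) (auto simp: indicator_def m_split A_zero)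
    also have "\<dots> = ennreal a + ?Q"
      by (subst nn_integral_add) (auto simp: a_eq)
    finally have MQ: "ennreal M = ennreal a + ?Q" .
    then have Q: "?Q = ennreal (M - a)"
      using a by (simp add: ennreal_minus[symmetric])
    \<comment> \<open>This rules out truncation in \<open>ennreal (M - a)\<close>, so that the four
      integrals below can be added as real numbers.\<close>
    have a_le: "a \<le> M"
      using MQ M_pos a by (metis ennreal_le_iff le_iff_add less_imp_le)
    \<comment> \<open>The summands dominate, in order, the lower component of the approximation,
      that of \<open>m\<close>, the excess from rescaling the rest by \<open>1 / M\<close>, and the
      tail beyond \<open>L\<close>.\<close>
    define h where "h x = ennreal (p / M) * ennreal (unif_density l x) + A x
      + ennreal (1 / M - 1) * (ennreal (b x + c) * indicator {0..L} x)
      + m x * indicator {L<..} x" for x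
    \<comment> \<open>The point \<open>0\<close> is left out because \<open>m 0\<close> may be
      infinite; it is a null set.\<close>
    have bound: "e2ennreal \<bar>ereal (m_dagger P m l L x) - enn2ereal (m x)\<bar> \<le> h x" if "0 < x" for x
    proof (cases "x \<le> L")
      case True
      define \<alpha> where "\<alpha> = enn2real (A x)"
      have "A x < \<infinity>"
        using finite[OF that] m_split[of x] that True by (simp add: less_top)
      then have \<alpha>: "A x = ennreal \<alpha>" "0 \<le> \<alpha>"
        by (simp_all add: \<alpha>_def)
      have mx: "m x = ennreal (\<alpha> + b x + c)"
        using m_split[of x] that True \<alpha> b_nonneg[of x] c by (simp add: add.assoc)
      define \<delta> where "\<delta> = (1 / M - 1) * (b x + c)"
      define \<epsilon> where "\<epsilon> = p / M * unif_density l x"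
      have nonneg: "0 \<le> 1 / M - 1" "0 \<le> \<delta>" "0 \<le> \<epsilon>"
        using M_pos b_nonneg[of x] c p
        by (simp_all add: \<delta>_def \<epsilon>_def unif_density_nonneg)
      \<comment> \<open>The middle and upper components both enter the approximation with factor
        \<open>1 / M\<close>, so together they differ from their share of \<open>m\<close> by
        \<delta>; only the lower components, \<epsilon> and \<alpha>, are unrelated.\<close>
      have "m_dagger P m l L x - (\<alpha> + b x + c) = \<epsilon> - \<alpha> + \<delta>"
        using that True M_pos by (simp add: dag \<epsilon>_def \<delta>_def field_simps)
      then have "\<bar>m_dagger P m l L x - (\<alpha> + b x + c)\<bar> \<le> \<epsilon> + \<alpha> + \<delta>"
        using nonneg \<alpha> by linarith
      then have "e2ennreal \<bar>ereal (m_dagger P m l L x) - enn2ereal (m x)\<bar>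
          \<le> ennreal (\<epsilon> + \<alpha> + \<delta>)"
        unfolding mx using \<alpha> b_nonneg[of x] c
        by (subst e2ennreal_abs_diff_ennreal) (auto intro: ennreal_leI)
      also have "\<dots> = ennreal \<epsilon> + ennreal \<alpha> + ennreal \<delta>"
        using nonneg \<alpha> by simp
      also have "\<dots> = h x"
        using that True \<alpha> nonneg(1) M_pos p
        by (simp add: h_def \<epsilon>_def \<delta>_def ennreal_mult' del: times_divide_eq_left)
      finally show ?thesis .
    next
      case False
      then have "e2ennreal \<bar>ereal (m_dagger P m l L x) - enn2ereal (m x)\<bar> = m x"
        by (simp add: dag_zero flip: zero_ereal_def)
      then show ?thesis
        using False by (simp add: h_def)
    qed
    have "l1_dist (m_dagger P m l L) m \<le> (\<integral>\<^sup>+x. h x \<partial>lborel)"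
      unfolding l1_dist_def
      by (rule nn_integral_mono_AE, rule eventually_mono[OF AE_lborel_singleton[of 0]])
         (auto simp: indicator_def intro: bound)
    also have "\<dots> = ennreal (p / M) + ennreal a + ennreal (1 / M - 1) * ennreal (M - a)
        + ennreal (1 - M)"
      unfolding h_def
      by (subst nn_integral_add; simp add: nn_integral_add nn_integral_cmult
          nn_integral_unif_density a_eq Q M(2) assms(4))
    also have "\<dots> = ennreal (p / M + a + (1 / M - 1) * (M - a) + (1 - M))"
      using M_pos p a a_le by (simp add: ennreal_mult)
    also have "\<dots> \<le> ennreal (2 * (1 - M + p / M))"
    proof (rule ennreal_leI)
      \<comment> \<open>The total becomes \<open>2 * (1 - M) + p / M + 2 * a - a / M\<close>. As
        \<open>M \<le> 1\<close>, one \<open>a\<close> is absorbed by \<open>a / M\<close>, and the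
        other is at most \<open>p \<le> p / M\<close>.\<close>
      have "(1 / M - 1) * (M - a) = 1 - M - a / M + a"
        using M_pos by (simp add: field_simps)
      moreover have "a \<le> a / M" "p \<le> p / M"
        using M_pos a p by (simp_all add: le_divide_eq mult_left_le)
      ultimately show "p / M + a + (1 / M - 1) * (M - a) + (1 - M) \<le> 2 * (1 - M + p / M)"
        using a by simp
    qed
    finally show ?thesis .
  qed
  then show ?thesis
    by (simp add: M_def p_def)
qed

end
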